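(* Let $X=(X_1,\dots,X_d)\in M_n(\mathbb C)^d$ be a row contraction, i.e. $\|\sum_{i=1}^dX_iX_i^*\|<1$, and let $\alpha,\beta\in\mathbb C\langle x_1,\dots,x_d\rangle$ be noncommutative polynomials. Let $\tilde X=(\tilde X_1,\dots,\tilde X_d)$ with $\tilde X_i=P_X^{\dagger/2}(I_n\otimes X_i)P_X^{1/2}$. Then $$\mathcal V_X^*\big(\alpha(\tilde X)\beta(\tilde X)^*\otimes I_{n^2}\big)\mathcal V_X=\alpha(X)\beta(X)^*\otimes I_n .$$
   Context: $\otimes$ is the Kronecker product. $E_{ij}$ are the $n\times n$ matrix units, and $e_i$ the standard basis (column) vectors of $\mathbb C^n$. $\mathrm{vec}:M_n(\mathbb C)\to\mathbb C^{n^2}$ stacks columns. $\psi:M_{n^2}(\mathbb C)\to M_{n^2}(\mathbb C)$, $A\mapsto A^\psi$, is the linear map with $[C\otimes D]^\psi=\mathrm{vec}(D)\,\mathrm{vec}(C)^T$. For a row contraction $X$, $P_X=\big[(I_n\otimes I_n-\sum_{i=1}^d\overline{X_i}\otimes X_i)^{-1}\big]^\psi$ ($\overline{X_i}$ is the entrywise conjugate; the inverse exists). $P_X$ is positive semidefinite with $\operatorname{ran}P_X=\mathrm{vec}(\mathrm{alg}_X)$, where $\mathrm{alg}_X$ is the unital algebra generated by $X_1,\dots,X_d$. $P_X^{\dagger/2}$ denotes the Moore–Penrose pseudoinverse of $P_X^{1/2}$. $\Delta_X=I_n-\sum_{i=1}^dX_iX_i^*$. $\mathcal Q_{n,r}\in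 M_{nr}$ is the permutation matrix with $\mathcal Q_{n,r}(U\otimes V)\mathcal Q_{n,r}^T=V\otimes U$ for all $U\in M_n(\mathbb C)$, $V\in M_r(\mathbb C)$. The ampliated boomerang matrix is the $n^3r\times nr$ matrix $\breve B_r=\big(\sum_{i,j=1}^ne_i\otimes e_j\otimes I_r\otimes E_{ij}\big)\mathcal Q_{n,r}$. Finally $\mathcal V_X=(P_X^{1/2}\otimes I_n\otimes\Delta_X^{1/2})\breve B_n$, an $n^4\times n^2$ matrix, which is an isometry. *)

theory Defs
  imports "HOL-Analysis.Analysis" "HOL-Library.Poly_Mapping"
begin

text \<open>
  The dimension \<open>n\<close> and the number \<open>d\<close> of variables are the cardinalities of the index types
  \<open>'n\<close> and \<open>'d\<close>. The space \<open>\<complex>\<^bsup>nm\<^esup> = \<complex>\<^bsup>n\<^esup> \<otimes> \<complex>\<^bsup>m\<^esup>\<close> is indexed by the pairs \<open>'n \<times> 'm\<close>, read in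
  lexicographic order, so that the Kronecker product needs no index arithmetic.
\<close>

definition adj :: "complex^'n^'m \<Rightarrow> complex^'m^'n" where
  "adj A = transpose (map_matrix cnj A)"

definition cscale :: "complex \<Rightarrow> complex^'n^'m \<Rightarrow> complex^'n^'m" where
  "cscale c A = map_matrix ((*) c) A"

definition kron :: "complex^'b^'a \<Rightarrow> complex^'d^'c \<Rightarrow> complex^('b \<times> 'd)^('a \<times> 'c)"
    (infixr "\<otimes>\<^sub>K" 75) where
  "A \<otimes>\<^sub>K B = (\<chi> r c. A $ fst r $ fst c * B $ snd r $ snd c)"

definition kron_vec :: "complex^'a \<Rightarrow> complex^'b \<Rightarrow> complex^('a \<times> 'b)" where
  "kron_vec u v = (\<chi> r. u $ fst r * v $ snd r)"

text \<open>Kronecker product of a column with a matrix; the column index set \<open>1 \<times> 'c\<close> of the result is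
  identified with \<open>'c\<close>.\<close>

definition kron_col :: "complex^'a \<Rightarrow> complex^'c^'b \<Rightarrow> complex^'c^('a \<times> 'b)" where
  "kron_col u B = (\<chi> r c. u $ fst r * B $ snd r $ c)"

definition matrix_unit :: "'m \<Rightarrow> 'n \<Rightarrow> complex^'n^'m" where
  "matrix_unit i j = (\<chi> k l. if k = i \<and> l = j then 1 else 0)"

text \<open>Stacking columns: the first component of the index is the column, the second the row.\<close>

definition vec_cols :: "complex^'n^'m \<Rightarrow> complex^('n \<times> 'm)" where
  "vec_cols A = (\<chi> k. A $ snd k $ fst k)"

definition outer :: "complex^'a \<Rightarrow> complex^'b \<Rightarrow> complex^'b^'a" where
  "outer u v = (\<chi> i j. u $ i * v $ j)"

text \<open>The entry of \<open>C \<otimes> D\<close> at \<open>((a, b), (c, d))\<close> is \<open>C\<^sub>a\<^sub>c D\<^sub>b\<^sub>d\<close>, which is the entry of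
  \<open>vec D (vec C)\<^sup>T\<close> at \<open>((d, b), (c, a))\<close>.\<close>

definition psi :: "complex^('n::finite \<times> 'n)^('n \<times> 'n) \<Rightarrow> complex^('n \<times> 'n)^('n \<times> 'n)" where
  "psi A = (\<chi> r c. A $ (snd c, snd r) $ (fst c, fst r))"

lemma psi_kron: "psi (C \<otimes>\<^sub>K D) = outer (vec_cols D) (vec_cols C)"
  by (simp add: psi_def kron_def outer_def vec_cols_def vec_eq_iff mult.commute)

lemma psi_add: "psi (A + B) = psi A + psi B"
  by (simp add: psi_def vec_eq_iff)

lemma psi_cscale: "psi (cscale c A) = cscale c (psi A)"
  by (simp add: psi_def cscale_def map_matrix_def vec_eq_iff)

lemma sum_cscale_units:
  fixes A :: "complex^('n::finite \<times> 'n)^('n \<times> 'n)"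
  shows "A = (\<Sum>r\<in>UNIV. \<Sum>c\<in>UNIV.
    cscale (A $ r $ c) (matrix_unit (fst r) (fst c) \<otimes>\<^sub>K matrix_unit (snd r) (snd c)))"
proof -
  have unit: "matrix_unit (fst r) (fst c) \<otimes>\<^sub>K matrix_unit (snd r) (snd c) = matrix_unit r c"
    for r c :: "'n \<times> 'n"
    by (auto simp: kron_def matrix_unit_def vec_eq_iff prod_eq_iff)
  have "(\<Sum>r\<in>UNIV. \<Sum>c\<in>UNIV. cscale (A $ r $ c) (matrix_unit r c)) $ k $ l = A $ k $ l" for k l
  proof -
    have "(\<Sum>r\<in>UNIV. \<Sum>c\<in>UNIV. cscale (A $ r $ c) (matrix_unit r c)) $ k $ l
        = (\<Sum>r\<in>UNIV. \<Sum>c\<in>UNIV. if r = k then (if c = l then A $ r $ c else 0) else 0)"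
      by (auto simp: cscale_def map_matrix_def matrix_unit_def intro!: sum.cong)
    also have "\<dots> = (\<Sum>r\<in>UNIV. if r = k then (\<Sum>c\<in>UNIV. if c = l then A $ r $ c else 0) else 0)"
      by (intro sum.cong) auto
    finally show ?thesis by simp
  qed
  then show ?thesis unfolding unit by (simp add: vec_eq_iff)
qed

lemma psi_unique:
  fixes f :: "complex^('n::finite \<times> 'n)^('n \<times> 'n) \<Rightarrow> complex^('n \<times> 'n)^('n \<times> 'n)"
  assumes add: "\<And>A B. f (A + B) = f A + f B"
    and scale: "\<And>c A. f (cscale c A) = cscale c (f A)"
    and kron: "\<And>C D. f (C \<otimes>\<^sub>K D) = outer (vec_cols D) (vec_cols C)"
  shows "f = psi"
proof
  fix A :: "complex^('n \<times> 'n)^('n \<times> 'n)"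
  have sum: "g (\<Sum>i\<in>UNIV. h i) = (\<Sum>i\<in>UNIV. g (h i))"
    if "\<And>A B. g (A + B) = g A + g B"
    for g :: "complex^('n \<times> 'n)^('n \<times> 'n) \<Rightarrow> complex^('n \<times> 'n)^('n \<times> 'n)" and h :: "'n \<times> 'n \<Rightarrow> _"
  proof -
    have "g (0 + 0) = g 0 + g 0" by (rule that)
    then have "g 0 = 0" by simp
    then show ?thesis using sum_comp_morphism[of g h UNIV] that by (simp add: o_def)
  qed
  show "f A = psi A"
    by (subst (1 2) sum_cscale_units)
      (simp only: sum[OF add] sum[OF psi_add] scale psi_cscale kron psi_kron)
qed

definition psd :: "complex^'n^'n \<Rightarrow> bool" where
  "psd A \<longleftrightarrow> adj A = A \<and> (\<forall>v. 0 \<le> Re (\<Sum>i\<in>UNIV. cnj (v $ i) * (A *v v) $ i))"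

definition msqrt :: "complex^'n^'n \<Rightarrow> complex^'n^'n" where
  "msqrt A = (THE B. psd B \<and> B ** B = A)"

definition pinv :: "complex^'n^'m \<Rightarrow> complex^'m^'n" where
  "pinv A = (THE B. A ** B ** A = A \<and> B ** A ** B = B \<and>
     adj (A ** B) = A ** B \<and> adj (B ** A) = B ** A)"

definition row_contraction :: "('d::finite \<Rightarrow> complex^'n^'n) \<Rightarrow> bool" where
  "row_contraction X \<longleftrightarrow> onorm ((*v) (\<Sum>i\<in>UNIV. X i ** adj (X i))) < 1"

text \<open>A noncommutative polynomial is a finitely supported family of coefficients indexed by words over \<open>'d\<close>.\<close>

type_synonym 'd ncpoly = "'d list \<Rightarrow>\<^sub>0 complex"

definition word_eval :: "('d \<Rightarrow> complex^'n^'n) \<Rightarrow> 'd list \<Rightarrow> complex^'n^'n" where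
  "word_eval X w = foldr (\<lambda>i M. X i ** M) w (mat 1)"

definition nc_eval :: "'d ncpoly \<Rightarrow> ('d \<Rightarrow> complex^'n^'n) \<Rightarrow> complex^'n^'n" where
  "nc_eval p X = (\<Sum>w\<in>Poly_Mapping.keys p. cscale (Poly_Mapping.lookup p w) (word_eval X w))"

definition P_mat :: "('d::finite \<Rightarrow> complex^'n^'n) \<Rightarrow> complex^('n \<times> 'n)^('n \<times> 'n)" where
  "P_mat X = psi (matrix_inv (mat 1 \<otimes>\<^sub>K mat 1 - (\<Sum>i\<in>UNIV. map_matrix cnj (X i) \<otimes>\<^sub>K X i)))"

definition Delta :: "('d::finite \<Rightarrow> complex^'n^'n) \<Rightarrow> complex^'n^'n" where
  "Delta X = mat 1 - (\<Sum>i\<in>UNIV. X i ** adj (X i))"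

definition Q_mat :: "complex^('n::finite \<times> 'r::finite)^('r \<times> 'n)" where
  "Q_mat = (\<chi> a b. if fst a = snd b \<and> snd a = fst b then 1 else 0)"

lemma Q_mat_kron:
  fixes U :: "complex^'n^'n" and V :: "complex^'r^'r"
  shows "Q_mat ** (U \<otimes>\<^sub>K V) ** transpose Q_mat = V \<otimes>\<^sub>K U"
proof -
  have Q: "Q_mat $ a $ b = (if b = (snd a, fst a) then 1 else 0)" for a :: "'r \<times> 'n" and b
    by (auto simp: Q_mat_def prod_eq_iff)
  show ?thesis
    by (simp add: vec_eq_iff matrix_matrix_mult_def transpose_def Q kron_def if_distrib
        if_distribR mult.commute cong: if_cong)
qed

definition boomerang :: "complex^('n::finite \<times> 'r::finite)^(('n \<times> 'n) \<times> ('r \<times> 'n))" where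
  "boomerang =
     (\<Sum>i\<in>UNIV. \<Sum>j\<in>UNIV. kron_col (kron_vec (axis i 1) (axis j 1)) (mat 1 \<otimes>\<^sub>K matrix_unit i j))
     ** Q_mat"

definition V_mat ::
  "('d::finite \<Rightarrow> complex^'n^'n) \<Rightarrow> complex^('n \<times> 'n)^(('n \<times> 'n) \<times> ('n \<times> 'n))" where
  "V_mat X = (msqrt (P_mat X) \<otimes>\<^sub>K mat 1 \<otimes>\<^sub>K msqrt (Delta X)) ** boomerang"

definition X_tilde :: "('d::finite \<Rightarrow> complex^'n^'n) \<Rightarrow> 'd \<Rightarrow> complex^('n \<times> 'n)^('n \<times> 'n)" where
  "X_tilde X i = pinv (msqrt (P_mat X)) ** (mat 1 \<otimes>\<^sub>K X i) ** msqrt (P_mat X)"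

end

theory Submission
  imports Defs
begin

text \<open>
  Put \<open>S = P\<^sup>1\<^sup>/\<^sup>2\<close> and \<open>L\<^sub>i = I \<otimes> X\<^sub>i\<close>. Applying \<open>\<psi>\<close> to \<open>G = I + (\<Sum>\<^sub>i cnj X\<^sub>i \<otimes> X\<^sub>i) G\<close>, where
  \<open>G = (I - \<Sum>\<^sub>i cnj X\<^sub>i \<otimes> X\<^sub>i)\<^sup>-\<^sup>1\<close>, gives the Stein equation \<open>P = vec I (vec I)\<^sup>T + \<Sum>\<^sub>i L\<^sub>i P L\<^sub>i\<^sup>*\<close>.
  Because the row contraction is strict, its solution is unique and positive semidefinite. It
  dominates each \<open>L\<^sub>i P L\<^sub>i\<^sup>*\<close>, so \<open>L\<^sub>i\<close> preserves the range of \<open>P\<close>; therefore \<open>S X\<^sub>i~ = L\<^sub>i S\<close> and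
  \<open>S \<alpha>(X~) \<beta>(X~)\<^sup>* S = (I \<otimes> \<alpha>(X)) P (I \<otimes> \<beta>(X))\<^sup>*\<close>. Compression by the boomerang matrix pairs the
  first tensor factor with \<open>\<Delta>\<close>. This pairing takes \<open>P\<close> to \<open>I\<close>, since
  \<open>vec \<Delta> = (I - \<Sum>\<^sub>i cnj X\<^sub>i \<otimes> X\<^sub>i) vec I\<close>, and \<open>\<alpha>(X)\<close>, \<open>\<beta>(X)\<^sup>*\<close> pass through it.
\<close>

subsection \<open>Adjoints and Kronecker products\<close>

lemma matrix_vector_mult_scaleR_right: "A *v (c *\<^sub>R x) = c *\<^sub>R (A *v x)"
  for A :: "'a::real_algebra_1^'n^'m"
  by (simp add: vec_eq_iff matrix_vector_mult_def scaleR_sum_right)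

lemma matrix_vector_mult_scaleR_left: "(c *\<^sub>R A) *v x = c *\<^sub>R (A *v x)"
  for A :: "'a::real_algebra_1^'n^'m"
  by (simp add: vec_eq_iff matrix_vector_mult_def scaleR_sum_right)

lemma matrix_vector_mult_uminus: "(- A) *v x = - (A *v x)"
  for A :: "'a::ring_1^'n^'m"
  by (simp add: vec_eq_iff matrix_vector_mult_def sum_negf)

lemma matrix_add_rdistrib: "(A + B) ** C = A ** C + B ** C"
  by (simp add: vec_eq_iff matrix_matrix_mult_def distrib_right sum.distrib)

lemma matrix_diff_ldistrib: "A ** (B - C) = A ** B - A ** C"
  for A :: "'a::ring_1^'n^'m"
  by (simp add: vec_eq_iff matrix_matrix_mult_def right_diff_distrib sum_subtractf)

lemma matrix_diff_rdistrib: "(A - B) ** C = A ** C - B ** C"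
  for A :: "'a::ring_1^'n^'m"
  by (simp add: vec_eq_iff matrix_matrix_mult_def left_diff_distrib sum_subtractf)

lemma adj_nth [simp]: "adj A $ i $ j = cnj (A $ j $ i)"
  by (simp add: adj_def transpose_def map_matrix_def)

lemma adj_adj [simp]: "adj (adj A) = A"
  by (simp add: vec_eq_iff)

lemma adj_matrix_mult: "adj (A ** B) = adj B ** adj A"
  by (simp add: vec_eq_iff matrix_matrix_mult_def mult.commute)

lemma adj_add: "adj (A + B) = adj A + adj B"
  by (simp add: vec_eq_iff)

lemma adj_diff: "adj (A - B) = adj A - adj B"
  by (simp add: vec_eq_iff)

lemma adj_uminus: "adj (- A) = - adj A"
  by (simp add: vec_eq_iff)

lemma adj_scaleR: "adj (c *\<^sub>R A) = c *\<^sub>R adj A"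
  by (simp add: vec_eq_iff)

lemma adj_cscale: "adj (cscale c A) = cscale (cnj c) (adj A)"
  by (simp add: vec_eq_iff cscale_def map_matrix_def)

lemma adj_zero [simp]: "adj 0 = 0"
  by (simp add: vec_eq_iff)

lemma adj_sum: "adj (\<Sum>i\<in>I. A i) = (\<Sum>i\<in>I. adj (A i))"
  by (simp add: vec_eq_iff)

lemma adj_mat_1 [simp]: "adj (mat 1) = mat 1"
  by (auto simp: vec_eq_iff mat_def)

lemma adj_kron: "adj (A \<otimes>\<^sub>K B) = adj A \<otimes>\<^sub>K adj B"
  by (simp add: vec_eq_iff kron_def)

lemma kron_mult: "(A \<otimes>\<^sub>K B) ** (C \<otimes>\<^sub>K D) = (A ** C) \<otimes>\<^sub>K (B ** D)"
  by (simp add: vec_eq_iff kron_def matrix_matrix_mult_def sum_product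
      sum.cartesian_product UNIV_Times_UNIV[symmetric] case_prod_unfold mult_ac
      del: UNIV_Times_UNIV)

lemma kron_mat_1: "mat 1 \<otimes>\<^sub>K mat 1 = mat 1"
  by (auto simp: vec_eq_iff kron_def mat_def prod_eq_iff)

lemma kron_sum_right: "A \<otimes>\<^sub>K (\<Sum>i\<in>I. B i) = (\<Sum>i\<in>I. A \<otimes>\<^sub>K B i)"
  by (simp add: vec_eq_iff kron_def sum_distrib_left)

lemma kron_cscale_right: "A \<otimes>\<^sub>K cscale c B = cscale c (A \<otimes>\<^sub>K B)"
  by (simp add: vec_eq_iff kron_def cscale_def map_matrix_def)

lemma cscale_mult_left: "cscale c A ** B = cscale c (A ** B)"
  by (simp add: vec_eq_iff cscale_def map_matrix_def matrix_matrix_mult_def sum_distrib_left mult_ac)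

lemma cscale_mult_right: "A ** cscale c B = cscale c (A ** B)"
  by (simp add: vec_eq_iff cscale_def map_matrix_def matrix_matrix_mult_def sum_distrib_left mult_ac)

lemma matrix_mult_sum_left: "(\<Sum>i\<in>I. A i) ** B = (\<Sum>i\<in>I. A i ** B)"
  for A :: "'i \<Rightarrow> 'a::comm_ring_1^'n^'m"
  by (induction I rule: infinite_finite_induct) (auto simp: matrix_add_rdistrib)

lemma matrix_mult_sum_right: "A ** (\<Sum>i\<in>I. B i) = (\<Sum>i\<in>I. A ** B i)"
  for A :: "'a::comm_ring_1^'n^'m"
  by (induction I rule: infinite_finite_induct) (auto simp: matrix_add_ldistrib)

lemma sum_matrix_vector_mult: "(\<Sum>i\<in>I. A i) *v x = (\<Sum>i\<in>I. A i *v x)"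
  for A :: "'i \<Rightarrow> 'a::comm_ring_1^'n^'m"
  by (induction I rule: infinite_finite_induct) (auto simp: matrix_vector_mult_add_rdistrib)

text \<open>Here \<open>\<bullet>\<close> is the real inner product on complex vectors, the real
  part of the Hermitian one; \<open>adj\<close> still moves a matrix across it.\<close>

lemma inner_matrix_vector_adj: "(A *v x) \<bullet> y = x \<bullet> (adj A *v y)"
  for A :: "complex^'n^'m"
proof -
  have "(A *v x) \<bullet> y = (\<Sum>i\<in>UNIV. \<Sum>j\<in>UNIV. (A $ i $ j * x $ j) \<bullet> y $ i)"
    by (simp add: inner_vec_def matrix_vector_mult_def inner_sum_left)
  also have "\<dots> = (\<Sum>j\<in>UNIV. \<Sum>i\<in>UNIV. x $ j \<bullet> (cnj (A $ i $ j) * y $ i))"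
    by (subst sum.swap) (simp add: inner_complex_def algebra_simps)
  also have "\<dots> = x \<bullet> (adj A *v y)"
    by (simp add: inner_vec_def matrix_vector_mult_def inner_sum_right)
  finally show ?thesis .
qed

subsection \<open>Positive semidefinite matrices\<close>

lemma psd_iff_inner: "psd A \<longleftrightarrow> adj A = A \<and> (\<forall>x. 0 \<le> x \<bullet> (A *v x))"
proof -
  have "Re (\<Sum>i\<in>UNIV. cnj (v $ i) * (A *v v) $ i) = v \<bullet> (A *v v)" for v
    by (simp add: inner_vec_def inner_complex_def)
  then show ?thesis unfolding psd_def by simp
qed

lemma psd_adj: "psd A \<Longrightarrow> adj A = A"
  by (simp add: psd_iff_inner)

lemma psd_inner_nonneg: "psd A \<Longrightarrow> 0 \<le> x \<bullet> (A *v x)"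
  by (simp add: psd_iff_inner)

lemma psd_zero: "psd 0"
  by (simp add: psd_iff_inner)

lemma psd_add: "psd A \<Longrightarrow> psd B \<Longrightarrow> psd (A + B)"
  by (simp add: psd_iff_inner adj_add matrix_vector_mult_add_rdistrib inner_add_right)

lemma psd_scaleR: "psd A \<Longrightarrow> 0 \<le> c \<Longrightarrow> psd (c *\<^sub>R A)"
  by (simp add: psd_iff_inner adj_scaleR matrix_vector_mult_scaleR_left)

lemma psd_congruence:
  assumes "psd A"
  shows "psd (C ** A ** adj C)"
  using assms inner_matrix_vector_adj[of "adj C"]
  by (auto simp: psd_iff_inner adj_matrix_mult matrix_mul_assoc matrix_vector_mul_assoc[symmetric])
    metis

text \<open>Moving from \<open>x\<close> in the direction \<open>A *v x\<close> changes the form to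
  first order, so a nonnegative form can vanish at \<open>x\<close> only if this direction is
  zero.\<close>

lemma psd_form_eq_0:
  assumes A: "psd A" and x: "x \<bullet> (A *v x) = 0"
  shows "A *v x = 0"
proof (rule ccontr)
  define y where "y = A *v x"
  assume "A *v x \<noteq> 0"
  then have pos: "y \<bullet> y > 0" by (simp add: y_def)
  define b where "b = y \<bullet> (A *v y)"
  have b: "0 \<le> b" using A by (simp add: b_def psd_iff_inner)
  have form: "(x + t *\<^sub>R y) \<bullet> (A *v (x + t *\<^sub>R y)) = 2 * t * (y \<bullet> y) + t\<^sup>2 * b" for t
  proof -
    have "x \<bullet> (A *v y) = y \<bullet> y"
      using inner_matrix_vector_adj[of A x y] psd_adj[OF A] by (simp add: y_def)
    moreover have "A *v (x + t *\<^sub>R y) = y + t *\<^sub>R (A *v y)"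
      by (simp add: matrix_vector_right_distrib y_def matrix_vector_mult_scaleR_right)
    ultimately show ?thesis
      using x by (simp add: inner_add_left inner_add_right b_def y_def[symmetric]
          power2_eq_square algebra_simps)
  qed
  \<comment> \<open>The quadratic in \<open>t\<close> has its minimum at -(y \<bullet> y) / b; the
    denominator \<open>b + 1\<close> also covers \<open>b = 0\<close>.\<close>
  define t where "t = - (y \<bullet> y) / (b + 1)"
  have t: "t < 0" "t * (b + 1) = - (y \<bullet> y)" using pos b by (auto simp: t_def field_simps)
  have "0 \<le> 2 * t * (y \<bullet> y) + t\<^sup>2 * b"
    using psd_inner_nonneg[OF A, of "x + t *\<^sub>R y"] form[of t] by simp
  also have "\<dots> = t * (y \<bullet> y) - t\<^sup>2"
  proof -
    have "t\<^sup>2 * b = t * (t * (b + 1)) - t\<^sup>2" by (simp add: power2_eq_square algebra_simps)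
    then show ?thesis by (simp add: t(2))
  qed
  also have "\<dots> < 0"
    using mult_neg_pos[OF t(1) pos] zero_le_power2[of t] by linarith
  finally show False by simp
qed

lemma psd_antisym:
  assumes "psd A" "psd (- A)"
  shows "A = 0"
proof -
  have "A *v x = 0" for x
  proof (rule psd_form_eq_0[OF assms(1)])
    have "0 \<le> x \<bullet> (A *v x)" "0 \<le> x \<bullet> (- A *v x)"
      using assms by (auto intro: psd_inner_nonneg)
    then show "x \<bullet> (A *v x) = 0" by (simp add: matrix_vector_mult_uminus)
  qed
  then show ?thesis by (simp add: matrix_eq)
qed

text \<open>The form attains a minimum \<open>l\<close> on the compact unit sphere, at
  \<open>u\<close>. By homogeneity \<open>A - l *\<^sub>R mat 1\<close> is positive semidefinite,
  and its form vanishes at \<open>u\<close>, so \<open>psd_form_eq_0\<close> makes \<open>u\<close>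
  an eigenvector.\<close>

lemma hermitian_min_eigenvector:
  fixes A :: "complex^'n^'n"
  assumes "adj A = A"
  obtains u l where "norm u = 1" "A *v u = l *\<^sub>R u" "\<And>x. l * (x \<bullet> x) \<le> x \<bullet> (A *v x)"
proof -
  have "continuous_on (sphere 0 1) (\<lambda>x. x \<bullet> (A *v x))"
    by (intro continuous_intros matrix_vector_mult_linear_continuous_on)
  then obtain u where u: "norm u = 1"
    and min: "\<And>x. norm x = 1 \<Longrightarrow> u \<bullet> (A *v u) \<le> x \<bullet> (A *v x)"
    using continuous_attains_inf[of "sphere (0::complex^'n) 1" "\<lambda>x. x \<bullet> (A *v x)"] by auto
  define l where "l = u \<bullet> (A *v u)"
  have le: "l * (x \<bullet> x) \<le> x \<bullet> (A *v x)" for x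
  proof (cases "x = 0")
    case False
    have "l \<le> (inverse (norm x) *\<^sub>R x) \<bullet> (A *v (inverse (norm x) *\<^sub>R x))"
      unfolding l_def using False by (intro min) simp
    also have "\<dots> = (x \<bullet> (A *v x)) / (x \<bullet> x)"
      by (simp add: matrix_vector_mult_scaleR_right field_simps dot_square_norm power2_eq_square)
    finally show ?thesis using False by (simp add: field_simps)
  qed simp
  have l_mat: "(A - l *\<^sub>R mat 1) *v x = A *v x - l *\<^sub>R x" for x
    by (simp add: matrix_vector_mult_diff_rdistrib matrix_vector_mult_scaleR_left)
  have "psd (A - l *\<^sub>R mat 1)"
    using assms le by (simp add: psd_iff_inner adj_diff adj_scaleR l_mat inner_diff_right)
  moreover have "u \<bullet> ((A - l *\<^sub>R mat 1) *v u) = 0"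
    using u by (simp add: l_mat inner_diff_right l_def[symmetric] dot_square_norm)
  ultimately have "A *v u = l *\<^sub>R u"
    using psd_form_eq_0 l_mat by fastforce
  then show ?thesis using that u le by blast
qed

section \<open>Rank-one projections and spectral induction\<close>

definition rank_one :: "complex^'n \<Rightarrow> complex^'n^'n" where
  "rank_one u = outer u (\<chi> i. cnj (u $ i))"

lemma adj_rank_one: "adj (rank_one u) = rank_one u"
  by (simp add: vec_eq_iff rank_one_def outer_def mult.commute)

lemma mult_rank_one: "A ** rank_one u = outer (A *v u) (\<chi> i. cnj (u $ i))"
  by (simp add: vec_eq_iff rank_one_def outer_def matrix_matrix_mult_def matrix_vector_mult_def
      sum_distrib_right mult.assoc)

lemma mult_rank_one_eigenvector: "A *v u = l *\<^sub>R u \<Longrightarrow> A ** rank_one u = l *\<^sub>R rank_one u"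
  by (simp add: mult_rank_one) (simp add: vec_eq_iff outer_def rank_one_def)

lemma rank_one_mult_eigenvector:
  assumes "adj A = A" "A *v u = l *\<^sub>R u"
  shows "rank_one u ** A = l *\<^sub>R rank_one u"
  using adj_matrix_mult[of A "rank_one u"]
  by (simp add: mult_rank_one_eigenvector[OF assms(2)] adj_rank_one adj_scaleR assms(1))

lemma rank_one_apply_self:
  assumes "norm u = 1"
  shows "rank_one u *v u = u"
proof -
  have "(\<Sum>j\<in>UNIV. cnj (u $ j) * u $ j) = of_real (\<Sum>j\<in>UNIV. (norm (u $ j))\<^sup>2)"
    by (simp add: complex_norm_square[symmetric] mult.commute)
  also have "(\<Sum>j\<in>UNIV. (norm (u $ j))\<^sup>2) = u \<bullet> u"
    by (simp add: inner_vec_def dot_square_norm)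
  finally have "(\<Sum>j\<in>UNIV. cnj (u $ j) * u $ j) = 1"
    using assms by (simp add: dot_square_norm)
  then show ?thesis
    by (simp add: vec_eq_iff rank_one_def outer_def matrix_vector_mult_def mult.assoc
        sum_distrib_left[symmetric])
qed

lemma rank_one_idem: "norm u = 1 \<Longrightarrow> rank_one u ** rank_one u = rank_one u"
  by (simp add: mult_rank_one[of "rank_one u"] rank_one_apply_self rank_one_def[symmetric])

lemma psd_rank_one: "psd (rank_one u)"
proof -
  have "x \<bullet> (rank_one u *v x) = (norm (\<Sum>i\<in>UNIV. cnj (u $ i) * x $ i))\<^sup>2" for x
  proof -
    define s where "s = (\<Sum>i\<in>UNIV. cnj (u $ i) * x $ i)"
    have "x \<bullet> (rank_one u *v x) = (\<Sum>i\<in>UNIV. x $ i \<bullet> (u $ i * s))"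
      by (simp add: inner_vec_def matrix_vector_mult_def rank_one_def outer_def s_def
          sum_distrib_left mult.assoc)
    also have "\<dots> = (\<Sum>i\<in>UNIV. (cnj (u $ i) * x $ i) \<bullet> s)"
      by (simp add: inner_complex_def algebra_simps)
    also have "\<dots> = (norm s)\<^sup>2"
      by (simp add: inner_sum_left[symmetric] s_def[symmetric] power2_norm_eq_inner)
    finally show ?thesis by (simp add: s_def)
  qed
  then show ?thesis
    by (simp add: psd_iff_inner adj_rank_one)
qed

lemma mult_rank_one_eq_0: "A *v u = 0 \<Longrightarrow> A ** rank_one u = 0"
  by (simp add: mult_rank_one vec_eq_iff outer_def)

lemma rank_one_mult_eq_0: "adj A *v u = 0 \<Longrightarrow> rank_one u ** A = 0"
  using mult_rank_one_eq_0[of "adj A" u] adj_matrix_mult[of "adj A" "rank_one u"]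
  by (simp add: adj_rank_one)

text \<open>A minimal eigenvector of \<open>- A\<close> serves. Its eigenvalue is negative, since
  otherwise \<open>- A\<close> would be positive semidefinite too and \<open>psd_antisym\<close>
  would force \<open>A = 0\<close>.\<close>

lemma psd_pos_eigenvector:
  assumes A: "psd A" and nz: "A \<noteq> 0"
  obtains u l where "norm u = 1" "A *v u = l *\<^sub>R u" "0 < l"
proof -
  have "adj (- A) = - A" using A by (simp add: adj_uminus psd_adj)
  then obtain u m where u: "norm u = 1" "- A *v u = m *\<^sub>R u"
    and le: "\<And>x. m * (x \<bullet> x) \<le> x \<bullet> (- A *v x)"
    using hermitian_min_eigenvector by blast
  have eig: "A *v u = (- m) *\<^sub>R u"
    using u(2) by (simp add: matrix_vector_mult_uminus) (metis minus_minus)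
  have "m < 0"
  proof (rule ccontr)
    assume "\<not> m < 0"
    then have "0 \<le> x \<bullet> (- A *v x)" for x
      using le[of x] by (smt (verit) inner_ge_zero mult_nonneg_nonneg)
    then have "psd (- A)" using A by (simp add: psd_iff_inner adj_uminus)
    then show False using psd_antisym[OF A] nz by blast
  qed
  then show ?thesis using that[OF u(1) eig] by simp
qed

text \<open>The spectral theorem as an induction principle: the matrix is built from positive
  multiples of projections onto mutually orthogonal lines. Deflating by one eigenvector strictly
  enlarges the kernel, so the recursion ends.\<close>

lemma psd_induct [consumes 1, case_names zero update]:
  fixes A :: "complex^'n^'n"
  assumes "psd A" and zero: "Q 0"
    and update: "\<And>A u l. psd A \<Longrightarrow> A *v u = 0 \<Longrightarrow> norm u = 1 \<Longrightarrow> 0 < l \<Longrightarrow> Q A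
      \<Longrightarrow> Q (A + l *\<^sub>R rank_one u)"
  shows "Q A"
  using assms(1)
proof (induction "DIM(complex^'n) - dim {x. A *v x = 0}" arbitrary: A rule: less_induct)
  case less
  show ?case
  proof (cases "A = 0")
    case False
    obtain u l where u: "norm u = 1" "A *v u = l *\<^sub>R u" "0 < l"
      using psd_pos_eigenvector[OF less.prems False] .
    define B where "B = A - l *\<^sub>R rank_one u"
    have rank_one_A: "rank_one u ** A = l *\<^sub>R rank_one u"
      using u(2) less.prems by (simp add: rank_one_mult_eigenvector psd_adj)
    have A_rank_one: "A ** rank_one u = l *\<^sub>R rank_one u"
      using u(2) by (rule mult_rank_one_eigenvector)
    \<comment> \<open>Deflation is compression to the orthogonal complement of \<open>u\<close>,
      which keeps the matrix positive semidefinite.\<close>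
    have "(mat 1 - rank_one u) ** A ** adj (mat 1 - rank_one u) = B"
      by (simp add: B_def adj_diff adj_rank_one matrix_diff_ldistrib matrix_diff_rdistrib
          rank_one_A A_rank_one
          scalar_matrix_assoc[symmetric] rank_one_idem[OF u(1)])
    then have "psd B" using psd_congruence[OF less.prems] by metis
    have Bu: "B *v u = 0"
      using u by (simp add: B_def matrix_vector_mult_diff_rdistrib matrix_vector_mult_scaleR_left
          rank_one_apply_self)
    have "{x. A *v x = 0} \<subset> {x. B *v x = 0}"
    proof (rule psubsetI)
      show "{x. A *v x = 0} \<subseteq> {x. B *v x = 0}"
      proof safe
        fix x assume "A *v x = 0"
        moreover have "(rank_one u ** A) *v x = rank_one u *v (A *v x)"
          by (simp add: matrix_vector_mul_assoc)
        ultimately have "l *\<^sub>R (rank_one u *v x) = 0"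
          by (simp add: rank_one_A matrix_vector_mult_scaleR_left)
        then show "B *v x = 0"
          using \<open>A *v x = 0\<close>
          by (simp add: B_def matrix_vector_mult_diff_rdistrib matrix_vector_mult_scaleR_left)
      qed
      have "A *v u \<noteq> 0" using u by auto
      then show "{x. A *v x = 0} \<noteq> {x. B *v x = 0}" using Bu by blast
    qed
    moreover have "subspace {x. C *v x = 0}" for C :: "complex^'n^'n"
      by (rule subspaceI) (auto simp: matrix_vector_right_distrib matrix_vector_mult_scaleR_right)
    ultimately have "dim {x. A *v x = 0} < dim {x. B *v x = 0}"
      by (intro dim_psubset) (simp add: span_eq_iff[THEN iffD2])
    moreover have "dim {x. B *v x = 0} \<le> DIM(complex^'n)" by (rule dim_subset_UNIV)
    ultimately have "Q B" by (intro less.hyps \<open>psd B\<close>) linarith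
    then have "Q (B + l *\<^sub>R rank_one u)" using update \<open>psd B\<close> Bu u by blast
    then show ?thesis by (simp add: B_def)
  qed (simp add: zero)
qed

subsection \<open>Square roots and pseudoinverses\<close>

text \<open>In the induction step the root \<open>B\<close> of \<open>A\<close> kills
  \<open>u\<close>, because the squared norm of \<open>B *v u\<close> is the form of
  \<open>A\<close> at \<open>u\<close>. Hence the cross terms vanish and the new direction only
  needs the root of \<open>l\<close>.\<close>

lemma psd_sqrt_exists:
  assumes "psd A"
  shows "\<exists>B. psd B \<and> B ** B = A"
  using assms
proof (induction rule: psd_induct)
  case zero
  show ?case using psd_zero by (intro exI[of _ 0]) simp
next
  case (update A u l)
  then obtain B where B: "psd B" "B ** B = A" by blast
  have "(B *v u) \<bullet> (B *v u) = u \<bullet> (B ** B *v u)"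
    using inner_matrix_vector_adj[of B] B(1) by (simp add: psd_adj matrix_vector_mul_assoc)
  then have Bu: "B *v u = 0" using B update by simp
  then have "B ** rank_one u = 0" "rank_one u ** B = 0"
    using B(1) by (simp_all add: mult_rank_one_eq_0 rank_one_mult_eq_0 psd_adj)
  then have "(B + sqrt l *\<^sub>R rank_one u) ** (B + sqrt l *\<^sub>R rank_one u) = A + l *\<^sub>R rank_one u"
    using B(2) update
    by (simp add: matrix_add_ldistrib matrix_add_rdistrib matrix_scalar_ac
        scalar_matrix_assoc[symmetric] rank_one_idem)
  moreover have "psd (B + sqrt l *\<^sub>R rank_one u)"
    using B update by (intro psd_add psd_scaleR psd_rank_one) auto
  ultimately show ?case by blast
qed

text \<open>Since \<open>(B + C) D + D (B + C) = 2 (B\<^sup>2 - C\<^sup>2) = 0\<close> for \<open>D = B - C\<close>, an eigenvector of \<open>D\<close> with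
  nonzero eigenvalue has zero \<open>B\<close>- and \<open>C\<close>-form, so \<open>D\<close> kills it.\<close>

lemma psd_sqrt_unique:
  assumes B: "psd B" and C: "psd C" and eq: "B ** B = C ** C"
  shows "B = C"
proof -
  have psd_diff: "psd (B - C)" if B: "psd B" and C: "psd C" and eq: "B ** B = C ** C"
    for B C :: "complex^'n^'n"
  proof -
    define D where "D = B - C"
    have D: "adj D = D" using B C by (simp add: D_def adj_diff psd_adj)
    obtain u l where u: "norm u = 1" "D *v u = l *\<^sub>R u" "\<And>x. l * (x \<bullet> x) \<le> x \<bullet> (D *v x)"
      using hermitian_min_eigenvector[OF D] by blast
    have "(B + C) ** D + D ** (B + C) = 0"
      using eq by (simp add: D_def matrix_add_ldistrib matrix_add_rdistrib matrix_diff_ldistrib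
          matrix_diff_rdistrib)
    then have "0 = u \<bullet> (((B + C) ** D + D ** (B + C)) *v u)" by simp
    also have "\<dots> = u \<bullet> ((B + C) *v (D *v u)) + (D *v u) \<bullet> ((B + C) *v u)"
      by (simp add: matrix_vector_mult_add_rdistrib inner_add_right matrix_vector_mul_assoc
          matrix_add_ldistrib inner_matrix_vector_adj D)
    also have "\<dots> = 2 * l * (u \<bullet> (B *v u) + u \<bullet> (C *v u))"
      by (simp add: u(2) matrix_vector_mult_scaleR_right matrix_vector_mult_add_rdistrib
          inner_add_right algebra_simps)
    finally have "l = 0 \<or> u \<bullet> (B *v u) + u \<bullet> (C *v u) = 0" by simp
    then have "l = 0"
    proof
      assume "u \<bullet> (B *v u) + u \<bullet> (C *v u) = 0"
      then have 0: "u \<bullet> (B *v u) = 0" "u \<bullet> (C *v u) = 0"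
        using psd_inner_nonneg[OF B, of u] psd_inner_nonneg[OF C, of u] by auto
      then have "D *v u = 0"
        using psd_form_eq_0[OF B 0(1)] psd_form_eq_0[OF C 0(2)]
        by (simp add: D_def matrix_vector_mult_diff_rdistrib)
      then show "l = 0" using u by auto
    qed
    then show ?thesis using u(3) D unfolding D_def[symmetric] by (simp add: psd_iff_inner)
  qed
  have "psd (B - C)" "psd (- (B - C))"
    using psd_diff[OF B C eq] psd_diff[OF C B eq[symmetric]] by simp_all
  then show ?thesis using psd_antisym by force
qed

lemma
  assumes "psd A"
  shows psd_msqrt: "psd (msqrt A)" and msqrt_square: "msqrt A ** msqrt A = A"
proof -
  have "\<exists>!B. psd B \<and> B ** B = A"
    using psd_sqrt_exists[OF assms] psd_sqrt_unique by metis
  then have "psd (msqrt A) \<and> msqrt A ** msqrt A = A"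
    unfolding msqrt_def by (rule theI')
  then show "psd (msqrt A)" "msqrt A ** msqrt A = A" by auto
qed

text \<open>The property described in \<open>pinv\<close>, named so that existence and uniqueness
  can be stated separately.\<close>

definition penrose :: "complex^'n^'m \<Rightarrow> complex^'m^'n \<Rightarrow> bool" where
  "penrose A B \<longleftrightarrow> A ** B ** A = A \<and> B ** A ** B = B \<and>
     adj (A ** B) = A ** B \<and> adj (B ** A) = B ** A"

text \<open>\<open>A ** B\<close> and \<open>A ** C\<close> are both the orthogonal projection onto
  the range of \<open>A\<close>, while \<open>B ** A\<close> and \<open>C ** A\<close> are the one
  onto the range of \<open>adj A\<close>. These projections determine the pseudoinverse.\<close>

lemma penrose_unique:
  assumes B: "penrose A B" and C: "penrose A C"
  shows "B = C"
proof -
  have "adj (A ** B) = adj (A ** C ** (A ** B))"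
    using C by (simp add: penrose_def matrix_mul_assoc)
  also have "\<dots> = A ** B ** (A ** C)"
    using B C by (simp add: adj_matrix_mult[of "A ** C" "A ** B"] penrose_def)
  also have "\<dots> = A ** C"
    using B by (simp add: penrose_def matrix_mul_assoc)
  finally have AB: "A ** B = A ** C" using B by (simp add: penrose_def)
  have "B ** A ** (C ** A) = B ** (A ** C ** A)" "C ** A ** (B ** A) = C ** (A ** B ** A)"
    by (simp_all only: matrix_mul_assoc)
  then have "B ** A ** (C ** A) = B ** A" "C ** A ** (B ** A) = C ** A"
    using B C by (simp_all add: penrose_def)
  moreover have "adj (B ** A ** (C ** A)) = C ** A ** (B ** A)"
    using B C by (simp add: adj_matrix_mult[of "B ** A" "C ** A"] penrose_def)
  ultimately have BA: "B ** A = C ** A" using B by (simp add: penrose_def)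
  have "B = B ** A ** B" using B by (simp add: penrose_def)
  also have "\<dots> = C ** (A ** C)" using BA AB by (simp add: matrix_mul_assoc[symmetric])
  also have "\<dots> = C" using C by (simp add: penrose_def matrix_mul_assoc)
  finally show ?thesis .
qed

text \<open>The new direction \<open>u\<close> is inverted separately, with factor
  \<open>inverse l\<close>; this is compatible with \<open>B\<close> because \<open>B\<close> is
  annihilated by \<open>rank_one u\<close> from both sides.\<close>

lemma psd_penrose_exists:
  assumes "psd A"
  shows "\<exists>B. penrose A B"
  using assms
proof (induction rule: psd_induct)
  case zero
  show ?case by (intro exI[of _ 0]) (simp add: penrose_def)
next
  case (update A u l)
  then obtain B where "penrose A B" by blast
  then have B: "A ** B ** A = A" "B ** A ** B = B" "adj (A ** B) = A ** B" "adj (B ** A) = B ** A"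
    by (auto simp: penrose_def)
  have A_rank_one: "A ** rank_one u = 0" "rank_one u ** A = 0"
    using update by (simp_all add: mult_rank_one_eq_0 rank_one_mult_eq_0 psd_adj)
  \<comment> \<open>The symmetry conditions and \<open>adj A = A\<close> put a factor
    \<open>A\<close> at either end of \<open>B\<close>; this lets \<open>A *v u = 0\<close> pass to
    \<open>B\<close>.\<close>
  have "B = B ** adj (A ** B)" using B by (simp add: matrix_mul_assoc)
  also have "\<dots> = B ** adj B ** A"
    using update by (simp add: adj_matrix_mult psd_adj matrix_mul_assoc)
  finally have B1: "B = B ** adj B ** A" .
  have "B = adj (B ** A) ** B" using B by simp
  also have "\<dots> = A ** (adj B ** B)"
    using update by (simp add: adj_matrix_mult psd_adj matrix_mul_assoc)
  finally have B2: "B = A ** (adj B ** B)" .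
  have B_rank_one: "B ** rank_one u = 0"
    by (subst B1) (simp add: A_rank_one matrix_mul_assoc[symmetric])
  have rank_one_B: "rank_one u ** B = 0"
    by (subst B2) (simp add: A_rank_one matrix_mul_assoc)
  have prods: "(A + l *\<^sub>R rank_one u) ** (B + inverse l *\<^sub>R rank_one u) = A ** B + rank_one u"
    "(B + inverse l *\<^sub>R rank_one u) ** (A + l *\<^sub>R rank_one u) = B ** A + rank_one u"
    using update
    by (simp_all add: matrix_add_ldistrib matrix_add_rdistrib matrix_scalar_ac
        scalar_matrix_assoc[symmetric] rank_one_idem A_rank_one B_rank_one rank_one_B)
  have assoc0: "A ** B ** rank_one u = 0" "B ** A ** rank_one u = 0"
    by (simp_all add: matrix_mul_assoc[symmetric] A_rank_one B_rank_one)
  have "penrose (A + l *\<^sub>R rank_one u) (B + inverse l *\<^sub>R rank_one u)"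
    unfolding penrose_def prods using B update
    by (simp add: matrix_add_ldistrib matrix_add_rdistrib matrix_scalar_ac adj_add adj_rank_one
        scalar_matrix_assoc[symmetric] rank_one_idem A_rank_one B_rank_one rank_one_B assoc0)
  then show ?case by blast
qed

lemma psd_penrose_pinv:
  assumes "psd A"
  shows "penrose A (pinv A)"
proof -
  have "\<exists>!B. penrose A B"
    using psd_penrose_exists[OF assms] penrose_unique by blast
  then show ?thesis
    unfolding pinv_def penrose_def[symmetric] by (rule theI')
qed

subsection \<open>Stein equations\<close>

text \<open>An eigenvector for a negative least eigenvalue \<open>l\<close> of \<open>Y\<close> would give \<open>l \<ge> l c\<close>.\<close>

lemma stein_psd:
  fixes L :: "'d::finite \<Rightarrow> complex^'n^'n"
  assumes c: "c < 1"
    and contr: "\<And>x. (\<Sum>i\<in>UNIV. (norm (adj (L i) *v x))\<^sup>2) \<le> c * (norm x)\<^sup>2"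
    and herm: "adj Y = Y"
    and psd: "psd (Y - (\<Sum>i\<in>UNIV. L i ** Y ** adj (L i)))"
  shows "psd Y"
proof -
  obtain u l where u: "norm u = 1" "Y *v u = l *\<^sub>R u" and le: "\<And>x. l * (x \<bullet> x) \<le> x \<bullet> (Y *v x)"
    using hermitian_min_eigenvector[OF herm] by blast
  have "0 \<le> l"
  proof (rule ccontr)
    assume "\<not> 0 \<le> l"
    have "0 \<le> u \<bullet> ((Y - (\<Sum>i\<in>UNIV. L i ** Y ** adj (L i))) *v u)"
      using psd by (rule psd_inner_nonneg)
    also have "\<dots> = l - (\<Sum>i\<in>UNIV. u \<bullet> (L i ** Y ** adj (L i) *v u))"
      using u by (simp add: matrix_vector_mult_diff_rdistrib sum_matrix_vector_mult inner_diff_right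
          inner_sum_right dot_square_norm)
    also have "(\<Sum>i\<in>UNIV. u \<bullet> (L i ** Y ** adj (L i) *v u))
        = (\<Sum>i\<in>UNIV. (adj (L i) *v u) \<bullet> (Y *v (adj (L i) *v u)))"
      by (simp add: inner_matrix_vector_adj matrix_vector_mul_assoc matrix_mul_assoc)
    also have "l - \<dots> \<le> l - l * (\<Sum>i\<in>UNIV. (norm (adj (L i) *v u))\<^sup>2)"
      using le by (auto simp: sum_distrib_left dot_square_norm intro!: sum_mono)
    also have "\<dots> \<le> l - l * c"
      using contr[of u] u \<open>\<not> 0 \<le> l\<close> by (auto intro: mult_left_mono_neg)
    also have "\<dots> = l * (1 - c)" by (simp add: algebra_simps)
    also have "\<dots> < 0" using c \<open>\<not> 0 \<le> l\<close> by (intro mult_neg_pos) auto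
    finally show False by simp
  qed
  then show ?thesis
    using le herm unfolding psd_iff_inner by (smt (verit) inner_ge_zero mult_nonneg_nonneg)
qed

text \<open>A Hermitian solution and its negative are both positive semidefinite by
  \<open>stein_psd\<close>, so it is zero. The general case is reduced to this one.\<close>

lemma stein_unique:
  fixes L :: "'d::finite \<Rightarrow> complex^'n^'n"
  assumes c: "c < 1"
    and contr: "\<And>x. (\<Sum>i\<in>UNIV. (norm (adj (L i) *v x))\<^sup>2) \<le> c * (norm x)\<^sup>2"
    and Y: "Y = (\<Sum>i\<in>UNIV. L i ** Y ** adj (L i))"
  shows "Y = 0"
proof -
  define \<phi> where "\<phi> Z = (\<Sum>i\<in>UNIV. L i ** Z ** adj (L i))" for Z
  have add: "\<phi> (A + B) = \<phi> A + \<phi> B" for A B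
    by (simp add: \<phi>_def matrix_add_ldistrib matrix_add_rdistrib sum.distrib)
  have scale: "\<phi> (cscale a A) = cscale a (\<phi> A)" for a A
    by (simp add: \<phi>_def cscale_mult_left cscale_mult_right)
      (simp add: vec_eq_iff cscale_def map_matrix_def sum_distrib_left)
  have neg: "\<phi> (- A) = - \<phi> A" for A
    using add[of A "- A"] add[of 0 0] by (simp add: eq_neg_iff_add_eq_0 add.commute)
  have adj: "\<phi> (adj A) = adj (\<phi> A)" for A
    by (simp add: \<phi>_def adj_sum adj_matrix_mult matrix_mul_assoc)
  have herm: "Z = 0" if "adj Z = Z" "\<phi> Z = Z" for Z
  proof (rule psd_antisym)
    show "psd Z"
      using stein_psd[OF c contr that(1)] that(2) psd_zero by (simp add: \<phi>_def)
    show "psd (- Z)"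
      using stein_psd[OF c contr, of "- Z"] that neg[of Z] psd_zero by (simp add: \<phi>_def adj_uminus)
  qed
  have fixp: "\<phi> Y = Y" using Y by (simp add: \<phi>_def)
  \<comment> \<open>Twice the Hermitian part of \<open>Y\<close> is a Hermitian fixed point. Once it
    vanishes, \<open>Y\<close> is skew-Hermitian and \<open>cscale \<i> Y\<close> is
    Hermitian.\<close>
  have "Y + adj Y = 0"
    by (rule herm) (simp_all add: adj_add add adj fixp add.commute)
  then have "adj Y = - Y" by (simp add: eq_neg_iff_add_eq_0 add.commute)
  then have "adj (cscale \<i> Y) = cscale \<i> Y"
    by (simp add: adj_cscale) (simp add: cscale_def map_matrix_def vec_eq_iff)
  then have "cscale \<i> Y = 0"
    by (rule herm) (simp add: scale fixp)
  then show ?thesis by (simp add: cscale_def map_matrix_def vec_eq_iff)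
qed

text \<open>The sum is the quadratic form of the matrix in \<open>row_contraction\<close>, so the
  operator norm of that matrix serves as \<open>c\<close>.\<close>

lemma row_contraction_bound:
  fixes X :: "'d::finite \<Rightarrow> complex^'n^'n"
  assumes "row_contraction X"
  obtains c where "c < 1" "\<And>x. (\<Sum>i\<in>UNIV. (norm (adj (X i) *v x))\<^sup>2) \<le> c * (norm x)\<^sup>2"
proof -
  define R where "R = (\<Sum>i\<in>UNIV. X i ** adj (X i))"
  have "linear ((*v) R)"
    by (intro linearI) (simp_all add: matrix_vector_right_distrib matrix_vector_mult_scaleR_right)
  then have bl: "bounded_linear ((*v) R)" by (simp add: linear_conv_bounded_linear)
  have "(\<Sum>i\<in>UNIV. (norm (adj (X i) *v x))\<^sup>2) \<le> onorm ((*v) R) * (norm x)\<^sup>2" for x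
  proof -
    have "(\<Sum>i\<in>UNIV. (norm (adj (X i) *v x))\<^sup>2) = x \<bullet> (R *v x)"
      by (simp add: R_def sum_matrix_vector_mult inner_sum_right power2_norm_eq_inner
          inner_matrix_vector_adj matrix_vector_mul_assoc)
    also have "\<dots> \<le> norm x * norm (R *v x)" by (rule norm_cauchy_schwarz)
    also have "\<dots> \<le> norm x * (onorm ((*v) R) * norm x)"
      using onorm[OF bl] by (intro mult_left_mono) auto
    finally show ?thesis by (simp add: power2_eq_square mult_ac)
  qed
  then show ?thesis using that assms by (auto simp: row_contraction_def R_def)
qed

lemma sum_prod_UNIV: "(\<Sum>k\<in>UNIV. f k) = (\<Sum>a\<in>UNIV. \<Sum>b\<in>UNIV. f (a, b))"
  for f :: "'a::finite \<times> 'b::finite \<Rightarrow> 'c::comm_monoid_add"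
  by (simp add: sum.cartesian_product UNIV_Times_UNIV[symmetric] del: UNIV_Times_UNIV)

lemma sum_mat_1: "(\<Sum>c\<in>UNIV. (mat 1 :: complex^'n^'n) $ a $ c * f c) = f a"
  by (simp add: mat_def if_distribR if_distrib cong: if_cong)

lemma kron_mat_1_mult_nth:
  "((mat 1 \<otimes>\<^sub>K A) ** M) $ (a, b) $ k = (\<Sum>d\<in>UNIV. A $ b $ d * M $ (a, d) $ k)"
  by (simp add: matrix_matrix_mult_def kron_def sum_prod_UNIV mult.assoc sum_distrib_left[symmetric]
      sum_mat_1)

lemma kron_mat_1_mult_vector_nth:
  "((mat 1 \<otimes>\<^sub>K A) *v x) $ (a, b) = (A *v (\<chi> d. x $ (a, d))) $ b"
  by (simp add: matrix_vector_mult_def kron_def sum_prod_UNIV mult.assoc sum_distrib_left[symmetric]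
      sum_mat_1)

lemma norm_sq_blocks: "(norm x)\<^sup>2 = (\<Sum>a\<in>UNIV. (norm (\<chi> b. x $ (a, b)))\<^sup>2)"
  for x :: "complex^('a::finite \<times> 'b::finite)"
  by (simp add: power2_norm_eq_inner inner_vec_def sum_prod_UNIV)

text \<open>An ampliation acts separately on the blocks of \<open>x\<close> with fixed first index,
  so the bound is summed over these blocks with the same \<open>c\<close>.\<close>

lemma contraction_ampliation:
  fixes X :: "'d::finite \<Rightarrow> complex^'n^'n" and x :: "complex^('m::finite \<times> 'n)"
  assumes contr: "\<And>x. (\<Sum>i\<in>UNIV. (norm (adj (X i) *v x))\<^sup>2) \<le> c * (norm x)\<^sup>2"
  shows "(\<Sum>i\<in>UNIV. (norm (adj (mat 1 \<otimes>\<^sub>K X i) *v x))\<^sup>2) \<le> c * (norm x)\<^sup>2"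
proof -
  have "(\<Sum>i\<in>UNIV. (norm (adj (mat 1 \<otimes>\<^sub>K X i) *v x))\<^sup>2)
      = (\<Sum>i\<in>UNIV. \<Sum>a\<in>UNIV. (norm (adj (X i) *v (\<chi> b. x $ (a, b))))\<^sup>2)"
    by (subst norm_sq_blocks) (simp add: adj_kron kron_mat_1_mult_vector_nth)
  also have "\<dots> = (\<Sum>a\<in>UNIV. \<Sum>i\<in>UNIV. (norm (adj (X i) *v (\<chi> b. x $ (a, b))))\<^sup>2)"
    by (rule sum.swap)
  also have "\<dots> \<le> (\<Sum>a\<in>UNIV. c * (norm (\<chi> b. x $ (a, b)))\<^sup>2)"
    by (intro sum_mono contr)
  also have "\<dots> = c * (norm x)\<^sup>2"
    by (simp add: norm_sq_blocks[of x] sum_distrib_left)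
  finally show ?thesis .
qed

lemma psd_Delta:
  assumes "row_contraction X"
  shows "psd (Delta X)"
  unfolding psd_iff_inner
proof safe
  show "adj (Delta X) = Delta X"
    by (simp add: Delta_def adj_diff adj_sum adj_matrix_mult)
  fix x
  obtain c where c: "c < 1" "\<And>x. (\<Sum>i\<in>UNIV. (norm (adj (X i) *v x))\<^sup>2) \<le> c * (norm x)\<^sup>2"
    using row_contraction_bound[OF assms] by blast
  have "x \<bullet> (Delta X *v x) = (norm x)\<^sup>2 - (\<Sum>i\<in>UNIV. (norm (adj (X i) *v x))\<^sup>2)"
    by (simp add: Delta_def matrix_vector_mult_diff_rdistrib inner_diff_right sum_matrix_vector_mult
        inner_sum_right power2_norm_eq_inner inner_matrix_vector_adj matrix_vector_mul_assoc)
  moreover have "c * (norm x)\<^sup>2 \<le> 1 * (norm x)\<^sup>2"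
    using c(1) by (intro mult_right_mono) auto
  ultimately show "0 \<le> x \<bullet> (Delta X *v x)" using c(2)[of x] by simp
qed

subsection \<open>The matrix \<open>P\<close>\<close>

text \<open>The matrix of the Stein operator in the coordinates given by \<open>vec_cols\<close>;
  see \<open>K_mat_mult_vec_cols\<close>.\<close>

definition K_mat :: "('d::finite \<Rightarrow> complex^'n^'n) \<Rightarrow> complex^('n \<times> 'n)^('n \<times> 'n)" where
  "K_mat X = mat 1 \<otimes>\<^sub>K mat 1 - (\<Sum>i\<in>UNIV. map_matrix cnj (X i) \<otimes>\<^sub>K X i)"

lemma P_mat_eq: "P_mat X = psi (matrix_inv (K_mat X))"
  by (simp add: P_mat_def K_mat_def)

lemma vec_cols_diff: "vec_cols (A - B) = vec_cols A - vec_cols B"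
  by (simp add: vec_cols_def vec_eq_iff)

lemma vec_cols_sum: "vec_cols (\<Sum>i\<in>I. A i) = (\<Sum>i\<in>I. vec_cols (A i))"
  by (simp add: vec_cols_def vec_eq_iff)

lemma kron_mult_vec_cols: "(map_matrix cnj A \<otimes>\<^sub>K B) *v vec_cols Y = vec_cols (B ** Y ** adj A)"
  by (simp add: vec_eq_iff matrix_vector_mult_def kron_def vec_cols_def matrix_matrix_mult_def
      sum_prod_UNIV map_matrix_def sum_distrib_left sum_distrib_right mult_ac)

lemma K_mat_mult_vec_cols:
  "K_mat X *v vec_cols Y = vec_cols (Y - (\<Sum>i\<in>UNIV. X i ** Y ** adj (X i)))"
  by (simp add: K_mat_def matrix_vector_mult_diff_rdistrib sum_matrix_vector_mult kron_mat_1
      kron_mult_vec_cols vec_cols_diff vec_cols_sum)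

text \<open>A kernel vector is the vectorisation of a solution of the homogeneous Stein equation,
  which vanishes by \<open>stein_unique\<close>; for square matrices injectivity gives a two-sided
  inverse.\<close>

lemma matrix_inv_K_mat:
  assumes "row_contraction X"
  shows "matrix_inv (K_mat X) ** K_mat X = mat 1" "K_mat X ** matrix_inv (K_mat X) = mat 1"
proof -
  obtain c where c: "c < 1" "\<And>x. (\<Sum>i\<in>UNIV. (norm (adj (X i) *v x))\<^sup>2) \<le> c * (norm x)\<^sup>2"
    using row_contraction_bound[OF assms] by blast
  have "x = 0" if "K_mat X *v x = 0" for x
  proof -
    define Y where "Y = (\<chi> i j. x $ (j, i))"
    have x: "x = vec_cols Y" by (simp add: Y_def vec_cols_def vec_eq_iff)
    have "Y - (\<Sum>i\<in>UNIV. X i ** Y ** adj (X i)) = 0"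
      using that by (simp add: x K_mat_mult_vec_cols) (simp add: vec_cols_def vec_eq_iff)
    then have "Y = 0" by (intro stein_unique[OF c]) auto
    then show ?thesis by (simp add: x vec_cols_def vec_eq_iff)
  qed
  then have "\<exists>B. K_mat X ** B = mat 1 \<and> B ** K_mat X = mat 1"
    using matrix_left_invertible_ker[of "K_mat X"] matrix_left_right_inverse by blast
  from someI_ex[OF this]
  show "matrix_inv (K_mat X) ** K_mat X = mat 1" "K_mat X ** matrix_inv (K_mat X) = mat 1"
    by (simp_all add: matrix_inv_def)
qed

lemma psi_mat_1: "psi (mat 1) = outer (vec_cols (mat 1)) (vec_cols (mat 1))"
  using psi_kron[of "mat 1" "mat 1"] by (simp add: kron_mat_1)

lemma psi_sum: "psi (\<Sum>i\<in>I. A i) = (\<Sum>i\<in>I. psi (A i))"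
  by (simp add: psi_def vec_eq_iff)

text \<open>For \<open>G = C \<otimes>\<^sub>K D\<close> the left side is the outer product of vec(B
  D) and vec(cnj A C). Both vectors come from vec D and vec C by an ampliation, and transposing the
  second turns cnj A into the adjoint.\<close>

lemma psi_kron_cnj_mult:
  "psi ((map_matrix cnj A \<otimes>\<^sub>K B) ** G) = (mat 1 \<otimes>\<^sub>K B) ** psi G ** adj (mat 1 \<otimes>\<^sub>K A)"
proof -
  \<comment> \<open>Writing the right multiplication through \<open>adj\<close> lets
    \<open>kron_mat_1_mult_nth\<close> expand both factors.\<close>
  have "psi ((map_matrix cnj A \<otimes>\<^sub>K B) ** G)
      = (mat 1 \<otimes>\<^sub>K B) ** adj ((mat 1 \<otimes>\<^sub>K A) ** adj (psi G))"
    by (simp add: vec_eq_iff kron_mat_1_mult_nth sum_distrib_left)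
      (simp add: psi_def matrix_matrix_mult_def kron_def sum_prod_UNIV map_matrix_def mult_ac,
       subst sum.swap, simp)
  then show ?thesis by (simp add: adj_matrix_mult matrix_mul_assoc)
qed

lemma P_mat_stein:
  assumes "row_contraction X"
  shows "P_mat X = outer (vec_cols (mat 1)) (vec_cols (mat 1))
    + (\<Sum>i\<in>UNIV. (mat 1 \<otimes>\<^sub>K X i) ** P_mat X ** adj (mat 1 \<otimes>\<^sub>K X i))"
proof -
  define G where "G = matrix_inv (K_mat X)"
  have "mat 1 = K_mat X ** G" using matrix_inv_K_mat[OF assms] by (simp add: G_def)
  also have "\<dots> = G - (\<Sum>i\<in>UNIV. (map_matrix cnj (X i) \<otimes>\<^sub>K X i) ** G)"
    by (simp add: K_mat_def kron_mat_1 matrix_diff_rdistrib matrix_mult_sum_left)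
  finally have "G = mat 1 + (\<Sum>i\<in>UNIV. (map_matrix cnj (X i) \<otimes>\<^sub>K X i) ** G)"
    by (simp add: algebra_simps)
  then have "psi G = psi (mat 1 + (\<Sum>i\<in>UNIV. (map_matrix cnj (X i) \<otimes>\<^sub>K X i) ** G))"
    by simp
  then show ?thesis
    by (simp add: P_mat_eq G_def[symmetric] psi_add psi_mat_1 psi_sum psi_kron_cnj_mult)
qed

lemma psd_outer_vec_cols_mat_1:
  "psd (outer (vec_cols (mat 1)) (vec_cols (mat 1)) :: complex^('n::finite \<times> 'n)^('n \<times> 'n))"
proof -
  have "outer (vec_cols (mat 1)) (vec_cols (mat 1)) = rank_one (vec_cols (mat 1 :: complex^'n^'n))"
    by (auto simp: rank_one_def outer_def vec_cols_def mat_def vec_eq_iff)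
  then show ?thesis using psd_rank_one by metis
qed

text \<open>\<open>stein_psd\<close> asks for a Hermitian matrix, so symmetry comes first:
  \<open>P_mat X\<close> minus its adjoint solves the homogeneous Stein equation.\<close>

lemma psd_P_mat:
  fixes X :: "'d::finite \<Rightarrow> complex^'n^'n"
  assumes "row_contraction X"
  shows "psd (P_mat X)"
proof -
  define L where "L i = (mat 1 :: complex^'n^'n) \<otimes>\<^sub>K X i" for i
  define W where "W = outer (vec_cols (mat 1 :: complex^'n^'n)) (vec_cols (mat 1 :: complex^'n^'n))"
  obtain c where "c < 1" "\<And>x. (\<Sum>i\<in>UNIV. (norm (adj (X i) *v x))\<^sup>2) \<le> c * (norm x)\<^sup>2"
    using row_contraction_bound[OF assms] by blast
  then have c: "c < 1" "\<And>x. (\<Sum>i\<in>UNIV. (norm (adj (L i) *v x))\<^sup>2) \<le> c * (norm x)\<^sup>2"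
    unfolding L_def using contraction_ampliation[of X c] by blast+
  have P: "P_mat X = W + (\<Sum>i\<in>UNIV. L i ** P_mat X ** adj (L i))"
    unfolding W_def L_def by (rule P_mat_stein[OF assms])
  have W: "psd W" unfolding W_def by (rule psd_outer_vec_cols_mat_1)
  have "adj (P_mat X) = W + (\<Sum>i\<in>UNIV. L i ** adj (P_mat X) ** adj (L i))"
    by (subst P) (simp add: adj_add adj_sum adj_matrix_mult psd_adj[OF W] matrix_mul_assoc)
  then have "P_mat X - adj (P_mat X) = (W + (\<Sum>i\<in>UNIV. L i ** P_mat X ** adj (L i)))
      - (W + (\<Sum>i\<in>UNIV. L i ** adj (P_mat X) ** adj (L i)))"
    by (rule arg_cong2[OF P, where f = "(-)"])
  also have "\<dots> = (\<Sum>i\<in>UNIV. L i ** (P_mat X - adj (P_mat X)) ** adj (L i))"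
    by (simp add: matrix_diff_ldistrib matrix_diff_rdistrib sum_subtractf)
  finally have "P_mat X - adj (P_mat X) = 0" by (rule stein_unique[OF c])
  then have herm: "adj (P_mat X) = P_mat X" by simp
  have "P_mat X - (\<Sum>i\<in>UNIV. L i ** P_mat X ** adj (L i)) = W"
    unfolding diff_eq_eq by (rule P)
  then show ?thesis using W by (intro stein_psd[OF c herm]) simp
qed

text \<open>\<open>S ** pinv S\<close> is the orthogonal projection onto the range of
  \<open>S\<close>, so the claim is that \<open>mat 1 \<otimes>\<^sub>K X i\<close> preserves this
  range. The proof is dual: the adjoint preserves the kernel of \<open>S\<close>.\<close>

lemma range_msqrt_P_invariant:
  fixes X :: "'d::finite \<Rightarrow> complex^'n^'n"
  assumes "row_contraction X"
  defines "S \<equiv> msqrt (P_mat X)"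
  shows "S ** pinv S ** (mat 1 \<otimes>\<^sub>K X i) ** S = (mat 1 \<otimes>\<^sub>K X i) ** S"
proof -
  define L where "L i = (mat 1 :: complex^'n^'n) \<otimes>\<^sub>K X i" for i
  have P: "psd (P_mat X)" using assms(1) by (rule psd_P_mat)
  have S: "psd S" "S ** S = P_mat X"
    unfolding S_def using P by (rule psd_msqrt, rule msqrt_square)
  have SS: "S ** pinv S ** S = S" "adj (S ** pinv S) = S ** pinv S"
    using psd_penrose_pinv[OF S(1)] by (auto simp: penrose_def)
  have ker: "S *v (adj (L i) *v u) = 0" if u: "S *v u = 0" for u
  proof -
    have norm_S: "v \<bullet> (P_mat X *v v) = (norm (S *v v))\<^sup>2" for v
      using S by (simp add: power2_norm_eq_inner inner_matrix_vector_adj matrix_vector_mul_assoc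
          psd_adj S(2)[symmetric])
    define W where "W = outer (vec_cols (mat 1 :: complex^'n^'n)) (vec_cols (mat 1 :: complex^'n^'n))"
    have W: "psd W" unfolding W_def by (rule psd_outer_vec_cols_mat_1)
    \<comment> \<open>By the Stein equation this zero is a sum of nonnegative terms, so each of them
      vanishes.\<close>
    have "0 = u \<bullet> (P_mat X *v u)" using norm_S u by simp
    also have "\<dots> = u \<bullet> (W *v u) + (\<Sum>j\<in>UNIV. u \<bullet> ((L j ** P_mat X ** adj (L j)) *v u))"
      by (subst P_mat_stein[OF assms(1)])
        (simp add: W_def L_def matrix_vector_mult_add_rdistrib sum_matrix_vector_mult
          inner_add_right inner_sum_right)
    also have "(\<Sum>j\<in>UNIV. u \<bullet> ((L j ** P_mat X ** adj (L j)) *v u))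
        = (\<Sum>j\<in>UNIV. (norm (S *v (adj (L j) *v u)))\<^sup>2)"
      by (simp add: norm_S[symmetric])
        (simp add: inner_matrix_vector_adj matrix_vector_mul_assoc matrix_mul_assoc)
    finally have "(\<Sum>j\<in>UNIV. (norm (S *v (adj (L j) *v u)))\<^sup>2) \<le> 0"
      using psd_inner_nonneg[OF W, of u] by linarith
    then have "(\<Sum>j\<in>UNIV. (norm (S *v (adj (L j) *v u)))\<^sup>2) = 0"
      by (intro antisym sum_nonneg) auto
    then show ?thesis by (simp add: sum_nonneg_eq_0_iff)
  qed
  \<comment> \<open>\<open>mat 1 - S ** pinv S\<close> maps into the kernel of \<open>S\<close>, so
    \<open>ker\<close> applies to its values.\<close>
  have "S ** adj (L i) ** (mat 1 - S ** pinv S) = 0"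
  proof -
    have "adj (S ** (mat 1 - S ** pinv S)) = 0"
      using SS S(1) by (simp add: adj_matrix_mult[of S "mat 1 - S ** pinv S"] adj_diff psd_adj
        matrix_diff_rdistrib)
    then have "S ** (mat 1 - S ** pinv S) = 0" by (metis adj_adj adj_zero)
    then have "(S ** adj (L i) ** (mat 1 - S ** pinv S)) *v v = 0" for v
      using ker[of "(mat 1 - S ** pinv S) *v v"]
      by (simp add: matrix_vector_mul_assoc matrix_mul_assoc)
    then show ?thesis by (simp add: matrix_eq)
  qed
  then have "adj (S ** adj (L i) ** (mat 1 - S ** pinv S)) = 0" by simp
  then have "(mat 1 - S ** pinv S) ** (L i ** S) = 0"
    using SS(2) S(1)
    by (simp add: adj_matrix_mult[of "S ** adj (L i)" "mat 1 - S ** pinv S"]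
        adj_matrix_mult[of S "adj (L i)"] adj_diff psd_adj)
  then show ?thesis
    by (simp add: matrix_diff_rdistrib matrix_mul_assoc L_def)
qed

section \<open>Polynomial evaluation and the pairing of tensor factors\<close>

lemma word_eval_Nil: "word_eval X [] = mat 1"
  by (simp add: word_eval_def)

lemma word_eval_Cons: "word_eval X (i # w) = X i ** word_eval X w"
  by (simp add: word_eval_def)

lemma word_eval_intertwine:
  assumes "\<And>i. T ** Y i = L i ** T"
  shows "T ** word_eval Y w = word_eval L w ** T"
proof (induction w)
  case (Cons i w)
  have "T ** word_eval Y (i # w) = L i ** (T ** word_eval Y w)"
    by (simp add: word_eval_Cons assms matrix_mul_assoc)
  then show ?case by (simp add: Cons.IH word_eval_Cons matrix_mul_assoc)
qed (simp add: word_eval_Nil)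

lemma nc_eval_intertwine:
  assumes "\<And>i. T ** Y i = L i ** T"
  shows "T ** nc_eval p Y = nc_eval p L ** T"
  by (simp add: nc_eval_def matrix_mult_sum_left matrix_mult_sum_right cscale_mult_left
      cscale_mult_right word_eval_intertwine[of T Y L, OF assms])

lemma nc_eval_ampliation:
  "nc_eval p (\<lambda>i. (mat 1 :: complex^'m^'m) \<otimes>\<^sub>K X i) = mat 1 \<otimes>\<^sub>K nc_eval p X"
proof -
  have "word_eval (\<lambda>i. (mat 1 :: complex^'m^'m) \<otimes>\<^sub>K X i) w = mat 1 \<otimes>\<^sub>K word_eval X w" for w
    by (induction w) (simp_all add: word_eval_Nil word_eval_Cons kron_mat_1 kron_mult)
  then show ?thesis by (simp add: nc_eval_def kron_sum_right kron_cscale_right)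
qed

text \<open>The partial trace, over the first tensor factor, of
  \<open>(transpose D \<otimes>\<^sub>K mat 1) ** M\<close>.\<close>

definition partial_pairing ::
  "complex^'m^'m \<Rightarrow> complex^('m::finite \<times> 'n::finite)^('m \<times> 'n) \<Rightarrow> complex^'n^'n" where
  "partial_pairing D M = (\<chi> x y. \<Sum>a\<in>UNIV. \<Sum>b\<in>UNIV. D $ a $ b * M $ (a, x) $ (b, y))"

lemma partial_pairing_mult_left:
  "partial_pairing D ((mat 1 \<otimes>\<^sub>K A) ** M) = A ** partial_pairing D M"
proof -
  have "(\<Sum>a\<in>UNIV. \<Sum>b\<in>UNIV. \<Sum>z\<in>UNIV. D $ a $ b * (A $ x $ z * M $ (a, z) $ (b, y)))
      = (\<Sum>z\<in>UNIV. \<Sum>a\<in>UNIV. \<Sum>b\<in>UNIV. D $ a $ b * (A $ x $ z * M $ (a, z) $ (b, y)))" for x y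
    by (subst (2) sum.swap, subst sum.swap) simp
  then show ?thesis
    by (simp add: partial_pairing_def vec_eq_iff kron_mat_1_mult_nth matrix_matrix_mult_def[of A]
        sum_distrib_left mult_ac)
qed

lemma adj_partial_pairing: "adj (partial_pairing D M) = partial_pairing (adj D) (adj M)"
  by (simp add: vec_eq_iff partial_pairing_def) (subst sum.swap, simp)

text \<open>Adjoints reduce this to the left-hand rule, which is then used with \<open>adj D\<close>
  in place of \<open>D\<close>.\<close>

lemma partial_pairing_mult_right:
  "partial_pairing D (M ** adj (mat 1 \<otimes>\<^sub>K A)) = partial_pairing D M ** adj A"
proof -
  have "adj (partial_pairing D (M ** adj (mat 1 \<otimes>\<^sub>K A))) = adj (partial_pairing D M ** adj A)"
    by (simp add: adj_partial_pairing adj_matrix_mult partial_pairing_mult_left)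
  then show ?thesis by (metis adj_adj)
qed

text \<open>The index exchange in \<open>psi\<close> turns the pairing into the inverse of
  \<open>K_mat X\<close> applied to the vectorised \<open>Delta X\<close>, and
  \<open>Delta X\<close> is exactly what the Stein operator makes of the identity.\<close>

lemma partial_pairing_Delta_P:
  assumes "row_contraction X"
  shows "partial_pairing (Delta X) (P_mat X) = mat 1"
proof -
  have "K_mat X *v vec_cols (mat 1) = vec_cols (Delta X)"
    by (simp add: K_mat_mult_vec_cols Delta_def)
  then have "matrix_inv (K_mat X) *v vec_cols (Delta X) = vec_cols (mat 1)"
    using matrix_inv_K_mat(1)[OF assms] by (metis matrix_vector_mul_assoc matrix_vector_mul_lid)
  then have "(matrix_inv (K_mat X) *v vec_cols (Delta X)) $ (y, x) = mat 1 $ x $ y" for x y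
    by (simp add: vec_cols_def)
  moreover have "partial_pairing (Delta X) (P_mat X) $ x $ y
      = (matrix_inv (K_mat X) *v vec_cols (Delta X)) $ (y, x)" for x y
    by (simp add: partial_pairing_def P_mat_eq psi_def matrix_vector_mult_def sum_prod_UNIV
        vec_cols_def mult.commute) (rule sum.swap)
  ultimately show ?thesis by (simp add: vec_eq_iff)
qed

subsection \<open>Compression by the boomerang matrix\<close>

lemma sum_if_const: "(\<Sum>i\<in>I. if P then f i else 0) = (if P then (\<Sum>i\<in>I. f i) else 0)"
  by simp

text \<open>Thus the boomerang matrix sends e_x \<otimes> e_y to the sum over a of e_a \<otimes> e_x
  \<otimes> e_y \<otimes> e_a, with one index shared by the outer factors.\<close>

lemma boomerang_nth:
  "boomerang $ ((a, b), (r, m)) $ (x, y) = (if r = y \<and> m = a \<and> b = x then 1 else 0)"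
proof -
  define B :: "complex^('b \<times> 'a)^(('a \<times> 'a) \<times> ('b \<times> 'a))" where
    "B = (\<Sum>i\<in>UNIV. \<Sum>j\<in>UNIV. kron_col (kron_vec (axis i 1) (axis j 1)) (mat 1 \<otimes>\<^sub>K matrix_unit i j))"
  have B: "B $ ((a, b), (r, m)) $ k = (if k = (r, b) then if m = a then 1 else 0 else 0)" for k
  proof -
    have "kron_col (kron_vec (axis i 1) (axis j 1)) (mat 1 \<otimes>\<^sub>K matrix_unit i j) $ ((a, b), (r, m)) $ k
        = (if i = a then if j = b then if k = (r, b) then if m = a then 1 else 0 else 0 else 0 else 0)"
      for i j
      by (cases k) (auto simp: kron_col_def kron_vec_def kron_def matrix_unit_def mat_def axis_def)
    then show ?thesis by (simp add: B_def sum_if_const)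
  qed
  have "(B ** Q_mat) $ ((a, b), (r, m)) $ (x, y) = (if m = a then Q_mat $ (r, b) $ (x, y) else 0)"
    by (simp add: matrix_matrix_mult_def B if_distribR if_distrib[of "\<lambda>z. z * _"] cong: if_cong)
  then show ?thesis by (auto simp: boomerang_def B_def Q_mat_def)
qed

lemma mult_boomerang_nth:
  "(N ** boomerang) $ k $ (x, y) = (\<Sum>a\<in>UNIV. N $ k $ ((a, x), (y, a)))"
proof -
  have "(N ** boomerang) $ k $ (x, y) = (\<Sum>a\<in>UNIV. \<Sum>b\<in>UNIV. \<Sum>r\<in>UNIV. \<Sum>m\<in>UNIV.
      N $ k $ ((a, b), (r, m)) * (if r = y \<and> m = a \<and> b = x then 1 else 0))"
    by (simp add: matrix_matrix_mult_def sum_prod_UNIV boomerang_nth)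
  \<comment> \<open>The conjunction is split into nested conditionals, so that the sums collapse one
    index at a time.\<close>
  also have "\<dots> = (\<Sum>a\<in>UNIV. \<Sum>b\<in>UNIV. \<Sum>r\<in>UNIV. \<Sum>m\<in>UNIV.
      if b = x then if r = y then if m = a then N $ k $ ((a, b), (r, m)) else 0 else 0 else 0)"
    by (intro sum.cong refl) auto
  also have "\<dots> = (\<Sum>a\<in>UNIV. N $ k $ ((a, x), (y, a)))"
    by (simp add: sum_if_const)
  finally show ?thesis .
qed

lemma adj_boomerang_mult_nth:
  "(adj boomerang ** N) $ (x, y) $ k = (\<Sum>a\<in>UNIV. N $ ((a, x), (y, a)) $ k)"
proof -
  have "(adj boomerang ** N) $ (x, y) $ k = adj (adj N ** boomerang) $ (x, y) $ k"
    by (simp only: adj_matrix_mult adj_adj)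
  then show ?thesis by (simp add: mult_boomerang_nth)
qed

text \<open>The shared outer index contracts the first factor of \<open>M\<close> with
  \<open>D\<close>; the second factor of \<open>M\<close> and the identity in third position
  remain.\<close>

lemma boomerang_compress:
  "adj boomerang ** (M \<otimes>\<^sub>K mat 1 \<otimes>\<^sub>K D) ** boomerang = partial_pairing D M \<otimes>\<^sub>K mat 1"
  by (simp add: vec_eq_iff mult_boomerang_nth adj_boomerang_mult_nth matrix_mul_assoc[symmetric])
    (auto simp: kron_def partial_pairing_def mat_def mult_ac)

theorem theorem5p2:
  fixes X :: "'d::finite \<Rightarrow> complex^'n^'n"
    and \<alpha> \<beta> :: "'d ncpoly"
  assumes "row_contraction X"
  shows "adj (V_mat X)
      ** ((nc_eval \<alpha> (X_tilde X) ** adj (nc_eval \<beta> (X_tilde X)))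
          \<otimes>\<^sub>K (mat 1 :: complex^('n \<times> 'n)^('n \<times> 'n)))
      ** V_mat X
    = (nc_eval \<alpha> X ** adj (nc_eval \<beta> X)) \<otimes>\<^sub>K (mat 1 :: complex^'n^'n)"
proof -
  define S where "S = msqrt (P_mat X)"
  define D where "D = msqrt (Delta X)"
  have S: "adj S = S" "S ** S = P_mat X"
    using psd_P_mat[OF assms] by (simp_all add: S_def psd_msqrt psd_adj msqrt_square)
  have D: "adj D = D" "D ** D = Delta X"
    using psd_Delta[OF assms] by (simp_all add: D_def psd_msqrt psd_adj msqrt_square)
  \<comment> \<open>\<open>X_tilde\<close> begins with \<open>pinv S\<close>, so multiplying by
    \<open>S\<close> produces the projection that \<open>range_msqrt_P_invariant\<close>
    removes.\<close>
  have "S ** X_tilde X i = (mat 1 \<otimes>\<^sub>K X i) ** S" for i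
    using range_msqrt_P_invariant[OF assms, of i] by (simp add: X_tilde_def S_def matrix_mul_assoc)
  then have intertwine: "S ** nc_eval p (X_tilde X) = (mat 1 \<otimes>\<^sub>K nc_eval p X) ** S" for p
    using nc_eval_intertwine[of S "X_tilde X"] by (simp add: nc_eval_ampliation)
  define A where "A = nc_eval \<alpha> (X_tilde X) ** adj (nc_eval \<beta> (X_tilde X))"
  \<comment> \<open>\<open>V_mat\<close> supplies one \<open>S\<close> on each side of
    \<open>A\<close>. Each is carried through one polynomial, and the two meet in the middle as
    \<open>P_mat X\<close>.\<close>
  have "S ** A ** S = (S ** nc_eval \<alpha> (X_tilde X)) ** adj (S ** nc_eval \<beta> (X_tilde X))"
    by (simp add: A_def adj_matrix_mult S matrix_mul_assoc)
  also have "\<dots> = (mat 1 \<otimes>\<^sub>K nc_eval \<alpha> X) ** (P_mat X ** adj (mat 1 \<otimes>\<^sub>K nc_eval \<beta> X))"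
    unfolding intertwine
    by (simp add: adj_matrix_mult[of "mat 1 \<otimes>\<^sub>K nc_eval \<beta> X"] S(1) S(2)[symmetric]
        matrix_mul_assoc)
  finally have "partial_pairing (Delta X) (S ** A ** S) = nc_eval \<alpha> X ** adj (nc_eval \<beta> X)"
    by (simp add: partial_pairing_mult_left partial_pairing_mult_right
        partial_pairing_Delta_P[OF assms])
  moreover have "adj (V_mat X) ** (A \<otimes>\<^sub>K mat 1) ** V_mat X
      = adj boomerang ** ((S ** A ** S) \<otimes>\<^sub>K mat 1 \<otimes>\<^sub>K Delta X) ** boomerang"
  proof -
    \<comment> \<open>The identity is split over the last two tensor factors so that
      \<open>kron_mult\<close> works factor by factor; the last one gives
      \<open>D ** D\<close>.\<close>
    have "adj (V_mat X) ** (A \<otimes>\<^sub>K mat 1) ** V_mat X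
      = adj boomerang **
        ((S \<otimes>\<^sub>K mat 1 \<otimes>\<^sub>K D) ** (A \<otimes>\<^sub>K mat 1 \<otimes>\<^sub>K mat 1) ** (S \<otimes>\<^sub>K mat 1 \<otimes>\<^sub>K D)) ** boomerang"
      by (simp add: V_mat_def S_def[symmetric] D_def[symmetric] adj_matrix_mult adj_kron S D
          kron_mat_1 matrix_mul_assoc)
    then show ?thesis by (simp only: kron_mult D(2) matrix_mul_lid matrix_mul_rid)
  qed
  ultimately show ?thesis by (simp add: A_def boomerang_compress)
qed

end
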